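(* Let $\Delta=\mathrm{diag}(b_1,b_2,b_3)$ with $b_1,b_2,b_3$ distinct nonzero complex numbers, let $x,y,q_1,q_1'\in\mathbb C$ with $xy\neq0$ and $q_1\ne0$, and let $\mathcal L\subset M_3[\mathbb C]$ be the subspace with (canonical) basis $$L_1=\begin{bmatrix}1&0&0\\ x&0&0\\ y&0&0\end{bmatrix},\quad L_2=\begin{bmatrix}0&1&0\\ b_\Delta(3)x&x&0\\ b_\Delta(2)y&y&0\end{bmatrix},\quad Q_1'=\begin{bmatrix}0&0&1\\ q_1'&q_1&0\\ \frac yxq_1'+\frac yxb_\Delta(1)q_1&\frac yxq_1&0\end{bmatrix},$$ $$Q_2=\begin{bmatrix}0&0&0\\ \frac{b_\Delta(3)}{b_2}-\frac{q_1'}x&b_\Delta(3)-\frac{q_1}x&1\\ 0&0&0\end{bmatrix},\quad Q_3=\begin{bmatrix}0&0&0\\ 0&0&0\\ \frac{b_\Delta(2)}{b_3}-b_\Delta(1)\frac{q_1}x-\frac{q_1'}x&b_\Delta(2)-\frac{q_1}x&1\end{bmatrix}.$$ Then $\mathcal L$ is transitive.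
   Context: $M_3[\mathbb C]$ is the space of $3\times3$ complex matrices. $b_\Delta(1)=\frac1{b_3}-\frac1{b_2}$, $b_\Delta(2)=\frac1{b_3}-\frac1{b_1}$, $b_\Delta(3)=\frac1{b_2}-\frac1{b_1}$. The parameter $q_1'$ is independent of $q_1$. A subspace $\mathcal L\subset M_3[\mathbb C]$ is transitive if $\{Xv:X\in\mathcal L\}=\mathbb C^3$ for every nonzero $v\in\mathbb C^3$. *)

theory Defs
  imports "HOL-Analysis.Analysis"
begin

text \<open>
  The library's overloaded \<open>span\<close> on \<open>complex^3^3\<close> is the span over the reals, and \<open>(*s)\<close> would
  take its scalars from \<open>complex^3\<close>. Complex subspaces of matrices therefore come from the
  following interpretation.
\<close>

definition mscale :: "complex \<Rightarrow> complex^'n^'m \<Rightarrow> complex^'n^'m"  (infixr \<open>*\<^sub>m\<close> 75)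
  where "c *\<^sub>m A = (\<chi> i j. c * A $ i $ j)"

interpretation cmat: vector_space "mscale :: complex \<Rightarrow> complex^'n^'m \<Rightarrow> complex^'n^'m"
  by unfold_locales (simp_all add: mscale_def vec_eq_iff algebra_simps)

definition transitive_space :: "(complex^3^3) set \<Rightarrow> bool"
  where "transitive_space \<L> \<longleftrightarrow> (\<forall>v. v \<noteq> 0 \<longrightarrow> {X *v v | X. X \<in> \<L>} = UNIV)"

definition diag :: "complex^'n \<Rightarrow> complex^'n^'n"
  where "diag b = (\<chi> i j. if i = j then b $ i else 0)"

text \<open>The components of \<open>b_Delta \<Delta>\<close> are numbered 1, 2, 3 by the index type.\<close>

definition b_Delta :: "complex^3^3 \<Rightarrow> complex^3"
  where "b_Delta \<Delta> = vector
    [1 / \<Delta> $ 3 $ 3 - 1 / \<Delta> $ 2 $ 2,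
     1 / \<Delta> $ 3 $ 3 - 1 / \<Delta> $ 1 $ 1,
     1 / \<Delta> $ 2 $ 2 - 1 / \<Delta> $ 1 $ 1]"

definition L1 :: "complex \<Rightarrow> complex \<Rightarrow> complex^3^3"
  where "L1 x y = vector
    [vector [1, 0, 0],
     vector [x, 0, 0],
     vector [y, 0, 0]]"

definition L2 :: "complex^3^3 \<Rightarrow> complex \<Rightarrow> complex \<Rightarrow> complex^3^3"
  where "L2 \<Delta> x y = vector
    [vector [0, 1, 0],
     vector [b_Delta \<Delta> $ 3 * x, x, 0],
     vector [b_Delta \<Delta> $ 2 * y, y, 0]]"

definition Q1' :: "complex^3^3 \<Rightarrow> complex \<Rightarrow> complex \<Rightarrow> complex \<Rightarrow> complex \<Rightarrow> complex^3^3"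
  where "Q1' \<Delta> x y q1 q1' = vector
    [vector [0, 0, 1],
     vector [q1', q1, 0],
     vector [y / x * q1' + y / x * b_Delta \<Delta> $ 1 * q1, y / x * q1, 0]]"

definition Q2 :: "complex^3^3 \<Rightarrow> complex \<Rightarrow> complex \<Rightarrow> complex \<Rightarrow> complex^3^3"
  where "Q2 \<Delta> x q1 q1' = vector
    [vector [0, 0, 0],
     vector [b_Delta \<Delta> $ 3 / \<Delta> $ 2 $ 2 - q1' / x, b_Delta \<Delta> $ 3 - q1 / x, 1],
     vector [0, 0, 0]]"

definition Q3 :: "complex^3^3 \<Rightarrow> complex \<Rightarrow> complex \<Rightarrow> complex \<Rightarrow> complex^3^3"
  where "Q3 \<Delta> x q1 q1' = vector
    [vector [0, 0, 0],
     vector [0, 0, 0],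
     vector [b_Delta \<Delta> $ 2 / \<Delta> $ 3 $ 3 - b_Delta \<Delta> $ 1 * (q1 / x) - q1' / x,
             b_Delta \<Delta> $ 2 - q1 / x, 1]]"

text \<open>
  The five matrices are distinct and linearly independent for all values of the parameters, so
  they form a basis of their span.
\<close>

lemma spanning_matrices_basis:
  fixes \<Delta> :: "complex^3^3" and x y q1 q1' :: complex
  defines "B \<equiv> {L1 x y, L2 \<Delta> x y, Q1' \<Delta> x y q1 q1', Q2 \<Delta> x q1 q1', Q3 \<Delta> x q1 q1'}"
  shows "card B = 5" and "cmat.independent B"
proof -
  note mats = L1_def L2_def Q1'_def Q2_def Q3_def
  have nz: "A $ i $ j \<noteq> A' $ i $ j \<Longrightarrow> A \<noteq> A'" for A A' :: "complex^3^3" and i j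
    by auto
  have d: "L1 x y \<noteq> L2 \<Delta> x y" "L1 x y \<noteq> Q1' \<Delta> x y q1 q1'"
    "L1 x y \<noteq> Q2 \<Delta> x q1 q1'" "L1 x y \<noteq> Q3 \<Delta> x q1 q1'"
    by (rule nz[of _ 1 1], simp add: mats)+
  have d': "L2 \<Delta> x y \<noteq> Q1' \<Delta> x y q1 q1'" "L2 \<Delta> x y \<noteq> Q2 \<Delta> x q1 q1'"
    "L2 \<Delta> x y \<noteq> Q3 \<Delta> x q1 q1'"
    by (rule nz[of _ 1 2], simp add: mats)+
  have d'': "Q1' \<Delta> x y q1 q1' \<noteq> Q2 \<Delta> x q1 q1'" "Q1' \<Delta> x y q1 q1' \<noteq> Q3 \<Delta> x q1 q1'"
    by (rule nz[of _ 1 3], simp add: mats)+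
  have d''': "Q2 \<Delta> x q1 q1' \<noteq> Q3 \<Delta> x q1 q1'"
    by (rule nz[of _ 2 3], simp add: mats)
  note ds = d d' d'' d'''
  show "card B = 5"
    using ds by (simp add: B_def)
  have fin: "finite B" by (simp add: B_def)
  show "cmat.independent B"
  proof (rule cmat.independent_if_scalars_zero[OF fin])
    fix f A
    assume sum0: "(\<Sum>A\<in>B. f A *\<^sub>m A) = 0" and A: "A \<in> B"
    have "f (L1 x y) *\<^sub>m L1 x y + (f (L2 \<Delta> x y) *\<^sub>m L2 \<Delta> x y
        + (f (Q1' \<Delta> x y q1 q1') *\<^sub>m Q1' \<Delta> x y q1 q1'
        + (f (Q2 \<Delta> x q1 q1') *\<^sub>m Q2 \<Delta> x q1 q1' + f (Q3 \<Delta> x q1 q1') *\<^sub>m Q3 \<Delta> x q1 q1'))) = 0"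
      using sum0 ds by (simp add: B_def)
    then have e: "(f (L1 x y) *\<^sub>m L1 x y + (f (L2 \<Delta> x y) *\<^sub>m L2 \<Delta> x y
        + (f (Q1' \<Delta> x y q1 q1') *\<^sub>m Q1' \<Delta> x y q1 q1'
        + (f (Q2 \<Delta> x q1 q1') *\<^sub>m Q2 \<Delta> x q1 q1'
        + f (Q3 \<Delta> x q1 q1') *\<^sub>m Q3 \<Delta> x q1 q1')))) $ i $ j = 0" for i j
      by simp
    have "f (L1 x y) = 0" using e[of 1 1] by (simp add: mscale_def mats)
    moreover have "f (L2 \<Delta> x y) = 0" using e[of 1 2] by (simp add: mscale_def mats)
    moreover have "f (Q1' \<Delta> x y q1 q1') = 0" using e[of 1 3] by (simp add: mscale_def mats)
    moreover have "f (Q2 \<Delta> x q1 q1') = 0" using e[of 2 3] by (simp add: mscale_def mats)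
    moreover have "f (Q3 \<Delta> x q1 q1') = 0" using e[of 3 3] by (simp add: mscale_def mats)
    ultimately show "f A = 0"
      using A by (auto simp: B_def)
  qed
qed

end

theory Submission
  imports Defs
begin

text \<open>
  With \<open>t\<^sub>i = 1 / b\<^sub>i\<close>, every \<open>v \<noteq> 0\<close> admits three of the five matrices whose images of \<open>v\<close> are
  linearly independent. \<open>Q\<^sub>2 v\<close> and \<open>Q\<^sub>3 v\<close> are multiples \<open>A e\<^sub>2\<close> and \<open>B e\<^sub>3\<close> of unit vectors; which
  three matrices work depends on the vanishing of \<open>A\<close> and \<open>B\<close>. The critical case is
  \<open>v\<^sub>1 \<noteq> 0\<close>, \<open>A = B = 0\<close>: there the determinant of \<open>L\<^sub>1 v\<close>, \<open>L\<^sub>2 v\<close>, \<open>Q\<^sub>1' v\<close> reduces to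
  \<open>x y (t\<^sub>3 - t\<^sub>2) (t\<^sub>3 - t\<^sub>1) (t\<^sub>2 - t\<^sub>1) v\<^sub>1\<^sup>3\<close>.
\<close>

text \<open>The rows of an invertible matrix span the whole space. Transitivity thereby becomes a
  search for three images of \<open>v\<close> with nonzero determinant.\<close>

lemma vec_subspace_eq_UNIV_if_det_nz:
  fixes a b c :: "'a::field^3"
  assumes "vec.subspace S" and "a \<in> S" "b \<in> S" "c \<in> S"
    and "det (vector [a, b, c] :: 'a^3^3) \<noteq> 0"
  shows "S = UNIV"
proof -
  let ?A = "vector [a, b, c] :: 'a^3^3"
  have "vec.span (rows ?A) = UNIV"
    using assms(5) invertible_det_nz[of ?A] invertible_left_inverse[of ?A]
      matrix_left_invertible_span_rows_gen[of ?A] by blast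
  moreover have "rows ?A \<subseteq> S"
  proof
    fix r assume "r \<in> rows ?A"
    then obtain i where "r = ?A $ i" by (auto simp: rows_def row_def)
    then show "r \<in> S" using assms(2-4) exhaust_3[of i] by auto
  qed
  ultimately show ?thesis
    using vec.span_minimal[OF _ assms(1)] by blast
qed

text \<open>Evaluation at \<open>v\<close> is complex linear, so it carries a complex span to a
  complex subspace; \<open>vec.subspace\<close> keeps the scalars complex.\<close>

lemma subspace_orbit:
  fixes v :: "complex^'n"
  shows "vec.subspace {X *v v | X :: complex^'n^'m. X \<in> cmat.span B}"
proof (rule vec.subspaceI)
  have "0 = (0 :: complex^'n^'m) *v v" by simp
  then show "0 \<in> {X *v v | X :: complex^'n^'m. X \<in> cmat.span B}"
    using cmat.span_zero by blast
next
  fix p q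
  assume "p \<in> {X *v v | X :: complex^'n^'m. X \<in> cmat.span B}"
    and "q \<in> {X *v v | X :: complex^'n^'m. X \<in> cmat.span B}"
  then obtain X Y where "X \<in> cmat.span B" "p = X *v v" "Y \<in> cmat.span B" "q = Y *v v"
    by blast
  then have "p + q = (X + Y) *v v" "X + Y \<in> cmat.span B"
    by (simp_all add: matrix_vector_mult_add_rdistrib cmat.span_add)
  then show "p + q \<in> {X *v v | X. X \<in> cmat.span B}" by blast
next
  fix c p assume "p \<in> {X *v v | X. X \<in> cmat.span B}"
  then obtain X where X: "X \<in> cmat.span B" "p = X *v v" by blast
  have "c *s (X *v v) = (c *\<^sub>m X) *v v"
    by (simp add: vec_eq_iff matrix_vector_mult_def mscale_def sum_distrib_left mult.assoc)
  then show "c *s p \<in> {X *v v | X. X \<in> cmat.span B}"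
    using X cmat.span_scale by blast
qed

text \<open>The five listed vectors are the images of \<open>v\<close> under the basis, with
  \<open>k\<close> and \<open>k'\<close> standing for \<open>q1 / x\<close> and
  \<open>q1' / x\<close>. This rescaling makes all entries polynomial, so that
  \<open>algebra\<close> can settle the determinants.\<close>

lemma subspace_generators_eq_UNIV:
  fixes t1 t2 t3 x y k k' v1 v2 v3 :: complex and S :: "(complex^3) set"
  defines "A \<equiv> ((t2 - t1) * t2 - k') * v1 + (t2 - t1 - k) * v2 + v3"
    and "B \<equiv> ((t3 - t1) * t3 - (t3 - t2) * k - k') * v1 + (t3 - t1 - k) * v2 + v3"
  assumes S: "vec.subspace S"
    and L1: "vector [v1, x * v1, y * v1] \<in> S"
    and L2: "vector [v2, x * ((t2 - t1) * v1 + v2), y * ((t3 - t1) * v1 + v2)] \<in> S"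
    and Q1: "vector [v3, x * (k' * v1 + k * v2), y * (k' * v1 + (t3 - t2) * k * v1 + k * v2)] \<in> S"
    and Q2: "vector [0, A, 0] \<in> S" and Q3: "vector [0, 0, B] \<in> S"
    and t: "t1 \<noteq> t2" "t1 \<noteq> t3" "t2 \<noteq> t3"
    and xy: "x \<noteq> 0" "y \<noteq> 0" and v: "v1 \<noteq> 0 \<or> v2 \<noteq> 0 \<or> v3 \<noteq> 0"
  shows "S = UNIV"
proof -
  note span = vec_subspace_eq_UNIV_if_det_nz[OF S]
  note nz = t xy
  consider "v1 = 0" "v2 = 0" | "v1 = 0" "v2 \<noteq> 0" "A = 0" | "v1 = 0" "v2 \<noteq> 0" "B = 0"
    | "v1 = 0" "v2 \<noteq> 0" "A \<noteq> 0" "B \<noteq> 0"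
    | "v1 \<noteq> 0" "A \<noteq> 0" "B \<noteq> 0" | "v1 \<noteq> 0" "A = 0" "B \<noteq> 0" | "v1 \<noteq> 0" "A \<noteq> 0" "B = 0"
    | "v1 \<noteq> 0" "A = 0" "B = 0" by blast
  then show ?thesis
  proof cases
    case 1
    \<comment> \<open>Here \<open>A = B = v3\<close>, and the determinant is
      \<open>v3^3\<close>.\<close>
    show ?thesis
      by (rule span[OF Q1 Q2 Q3]) (use 1 v in \<open>simp add: det_3 A_def B_def\<close>)
  next
    case 2
    \<comment> \<open>For \<open>v1 = 0\<close> the difference \<open>B - A\<close> is
      \<open>(t3 - t2) * v2\<close>, so \<open>A\<close> and \<open>B\<close> cannot both vanish.
      Solving \<open>A = 0\<close> for \<open>v3\<close> also removes \<open>k\<close> from the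
      determinant.\<close>
    have v3: "v3 = (k - (t2 - t1)) * v2" using 2 unfolding A_def by algebra
    have B: "B = (t3 - t2) * v2" using 2 unfolding B_def v3 by algebra
    have "det (vector [vector [v2, x * ((t2 - t1) * v1 + v2), y * ((t3 - t1) * v1 + v2)],
        vector [v3, x * (k' * v1 + k * v2), y * (k' * v1 + (t3 - t2) * k * v1 + k * v2)],
        vector [0, 0, B]] :: complex^3^3) = x * (t2 - t1) * (t3 - t2) * v2^3"
      using 2 unfolding v3 B det_3 vector_3 by algebra
    then show ?thesis using 2 nz by (intro span[OF L2 Q1 Q3]) simp
  next
    case 3
    \<comment> \<open>The mirror image of the previous case, with indices 2 and 3 exchanged.\<close>
    have v3: "v3 = (k - (t3 - t1)) * v2" using 3 unfolding B_def by algebra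
    have A: "A = (t2 - t3) * v2" using 3 unfolding A_def v3 by algebra
    have "det (vector [vector [v2, x * ((t2 - t1) * v1 + v2), y * ((t3 - t1) * v1 + v2)],
        vector [v3, x * (k' * v1 + k * v2), y * (k' * v1 + (t3 - t2) * k * v1 + k * v2)],
        vector [0, A, 0]] :: complex^3^3) = - y * (t3 - t1) * (t2 - t3) * v2^3"
      using 3 unfolding v3 A det_3 vector_3 by algebra
    then show ?thesis using 3 nz by (intro span[OF L2 Q1 Q2]) simp
  next
    case 4
    show ?thesis by (rule span[OF L2 Q2 Q3]) (use 4 in \<open>simp add: det_3\<close>)
  next
    case 5
    show ?thesis by (rule span[OF L1 Q2 Q3]) (use 5 in \<open>simp add: det_3\<close>)
  next
    case 6
    \<comment> \<open>Subtracting \<open>v2 / v1\<close> times the first row from the second leaves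
      \<open>(0, x * (t2 - t1) * v1, y * (t3 - t1) * v1)\<close>, so \<open>v2\<close> drops out.
      The next case uses the other entry of this row.\<close>
    have "det (vector [vector [v1, x * v1, y * v1],
        vector [v2, x * ((t2 - t1) * v1 + v2), y * ((t3 - t1) * v1 + v2)],
        vector [0, 0, B]] :: complex^3^3) = x * (t2 - t1) * v1^2 * B"
      unfolding det_3 vector_3 by algebra
    then show ?thesis using 6 nz by (intro span[OF L1 L2 Q3]) simp
  next
    case 7
    have "det (vector [vector [v1, x * v1, y * v1],
        vector [v2, x * ((t2 - t1) * v1 + v2), y * ((t3 - t1) * v1 + v2)],
        vector [0, A, 0]] :: complex^3^3) = - y * (t3 - t1) * v1^2 * A"
      unfolding det_3 vector_3 by algebra
    then show ?thesis using 7 nz by (intro span[OF L1 L2 Q2]) simp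
  next
    case 8
    \<comment> \<open>Both \<open>k'\<close> and \<open>v3\<close> cancel in \<open>B - A\<close>,
      which fixes \<open>v2\<close> as a multiple of \<open>v1\<close>; then \<open>A = 0\<close>
      fixes \<open>v3\<close>.\<close>
    have "(t3 - t2) * (v2 - (k - t3 - t2 + t1) * v1) = B - A"
      unfolding A_def B_def by algebra
    then have v2: "v2 = (k - t3 - t2 + t1) * v1" using 8 nz by simp
    have v3: "v3 = - (((t2 - t1) * t2 - k') * v1 + (t2 - t1 - k) * v2)"
      using 8 unfolding A_def by algebra
    \<comment> \<open>After substitution \<open>k\<close> and \<open>k'\<close> cancel, leaving the
      Vandermonde product of the distinct \<open>t1\<close>, \<open>t2\<close>,
      \<open>t3\<close>.\<close>
    have "det (vector [vector [v1, x * v1, y * v1],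
        vector [v2, x * ((t2 - t1) * v1 + v2), y * ((t3 - t1) * v1 + v2)],
        vector [v3, x * (k' * v1 + k * v2), y * (k' * v1 + (t3 - t2) * k * v1 + k * v2)]] :: complex^3^3)
      = x * y * (t3 - t2) * (t3 - t1) * (t2 - t1) * v1^3"
      unfolding det_3 vector_3 v3 v2 by algebra
    then show ?thesis using 8 nz by (intro span[OF L1 L2 Q1]) simp
  qed
qed

theorem proposition43:
  fixes b1 b2 b3 x y q1 q1' :: complex
    and \<Delta> :: "complex^3^3" and \<L> :: "(complex^3^3) set"
  assumes "b1 \<noteq> 0" and "b2 \<noteq> 0" and "b3 \<noteq> 0"
    and "b1 \<noteq> b2" and "b1 \<noteq> b3" and "b2 \<noteq> b3"
    and "\<Delta> = diag (vector [b1, b2, b3])"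
    and "x * y \<noteq> 0" and "q1 \<noteq> 0"
    and "\<L> = cmat.span {L1 x y, L2 \<Delta> x y, Q1' \<Delta> x y q1 q1', Q2 \<Delta> x q1 q1', Q3 \<Delta> x q1 q1'}"
  shows "transitive_space \<L>"
  unfolding transitive_space_def
proof (intro allI impI)
  fix v :: "complex^3"
  assume "v \<noteq> 0"
  then have v: "v $ 1 \<noteq> 0 \<or> v $ 2 \<noteq> 0 \<or> v $ 3 \<noteq> 0"
    by (simp add: vec_eq_iff forall_3)
  let ?S = "{X *v v | X. X \<in> \<L>}"
  have b: "b_Delta \<Delta> $ 1 = 1 / b3 - 1 / b2" "b_Delta \<Delta> $ 2 = 1 / b3 - 1 / b1"
    "b_Delta \<Delta> $ 3 = 1 / b2 - 1 / b1" "\<Delta> $ 1 $ 1 = b1" "\<Delta> $ 2 $ 2 = b2" "\<Delta> $ 3 $ 3 = b3"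
    by (simp_all add: b_Delta_def assms(7) diag_def)
  have xy: "x \<noteq> 0" "y \<noteq> 0" using assms(8) by auto
  have mem: "w \<in> ?S"
    if "X *v v = w" "X \<in> {L1 x y, L2 \<Delta> x y, Q1' \<Delta> x y q1 q1', Q2 \<Delta> x q1 q1', Q3 \<Delta> x q1 q1'}" for X w
  proof -
    have "X \<in> \<L>" unfolding assms(10) using that(2) by (rule cmat.span_base)
    then show ?thesis using that(1) by blast
  qed
  note mv = vec_eq_iff forall_3 matrix_vector_mult_def sum_3 b
  show "?S = UNIV"
  proof (rule subspace_generators_eq_UNIV[where ?t1.0 = "1 / b1" and ?t2.0 = "1 / b2"
        and ?t3.0 = "1 / b3" and x = x and y = y and k = "q1 / x" and k' = "q1' / x"
        and ?v1.0 = "v $ 1" and ?v2.0 = "v $ 2" and ?v3.0 = "v $ 3"])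
    show "vec.subspace ?S"
      unfolding assms(10) by (rule subspace_orbit)
  next
    show "vector [v $ 1, x * v $ 1, y * v $ 1] \<in> ?S"
      by (rule mem[of "L1 x y"], simp add: mv L1_def, simp)
  next
    show "vector [v $ 2, x * ((1 / b2 - 1 / b1) * v $ 1 + v $ 2),
        y * ((1 / b3 - 1 / b1) * v $ 1 + v $ 2)] \<in> ?S"
      by (rule mem[of "L2 \<Delta> x y"], simp add: mv L2_def algebra_simps, simp)
  next
    show "vector [v $ 3, x * (q1' / x * v $ 1 + q1 / x * v $ 2),
        y * (q1' / x * v $ 1 + (1 / b3 - 1 / b2) * (q1 / x) * v $ 1 + q1 / x * v $ 2)] \<in> ?S"
      using xy by (intro mem[of "Q1' \<Delta> x y q1 q1'"], simp add: mv Q1'_def algebra_simps, simp)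
  next
    show "vector [0, ((1 / b2 - 1 / b1) * (1 / b2) - q1' / x) * v $ 1
        + (1 / b2 - 1 / b1 - q1 / x) * v $ 2 + v $ 3, 0] \<in> ?S"
      by (rule mem[of "Q2 \<Delta> x q1 q1'"], simp add: mv Q2_def, simp)
  next
    show "vector [0, 0, ((1 / b3 - 1 / b1) * (1 / b3) - (1 / b3 - 1 / b2) * (q1 / x) - q1' / x) * v $ 1
        + (1 / b3 - 1 / b1 - q1 / x) * v $ 2 + v $ 3] \<in> ?S"
      by (rule mem[of "Q3 \<Delta> x q1 q1'"], simp add: mv Q3_def, simp)
  qed (use assms(1-6) xy v in simp_all)
qed

end
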